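(* Let $G$ be a locally compact group, $K$ a compact subgroup with normalized Haar measure $dk$, $\delta>0$, and $\mu$ a continuous unitary character of $G$. Let $f,g\in\mathcal{C}(G)$ with $f$ $K$-central satisfy $$\Big|\int_K f(xkyk^{-1})\,dk+\mu(y)\int_K f(xky^{-1}k^{-1})\,dk-2f(x)g(y)\Big|\le\delta\quad\text{for all }x,y\in G.$$ Then one of the following holds: (1) $f$ and $g$ are bounded; (2) $f$ is unbounded and $g$ satisfies $\int_K g(xkyk^{-1})\,dk+\mu(y)\int_K g(xky^{-1}k^{-1})\,dk=2g(x)g(y)$ for all $x,y\in G$; (3) $g$ is unbounded and $(f,g)$ satisfies $\int_K f(xkyk^{-1})\,dk+\mu(y)\int_K f(xky^{-1}k^{-1})\,dk=2f(x)g(y)$ for all $x,y\in G$; moreover, in this case, if $f\neq0$ and $C_Kf\neq0$, then $g$ satisfies the equation in (2).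
   Context: A unitary character is a continuous homomorphism $\mu:G\to\{z\in\mathbb{C}:|z|=1\}$. $(C_Kf)(x)=\int_Kf(kxk^{-1})\,dk$. A function $f$ is $K$-central if $f(kx)=f(xk)$ for all $k\in K,x\in G$. *)

theory Defs
  imports "HOL-Analysis.Analysis" "HOL-Probability.Probability"
begin

text \<open>The group G is a type 'g of class topological_group_add (a possibly
non-commutative topological group written additively: x + y is the product,
-x the inverse, 0 the identity). Hausdorff via t2_space.\<close>

definition compact_subgroup :: "'g::{topological_group_add} set \<Rightarrow> bool" where
  "compact_subgroup K \<longleftrightarrow> compact K \<and> 0 \<in> K \<and>
     (\<forall>a\<in>K. \<forall>b\<in>K. a + b \<in> K) \<and> (\<forall>a\<in>K. - a \<in> K)"

definition normalized_haar :: "'g::{topological_group_add} set \<Rightarrow> 'g measure \<Rightarrow> bool" where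
  "normalized_haar K M \<longleftrightarrow> prob_space M \<and> space M = K \<and>
     sets M = sets (restrict_space borel K) \<and>
     (\<forall>k\<in>K. \<forall>A\<in>sets M. emeasure M ((\<lambda>x. k + x) ` A) = emeasure M A) \<and>
     (\<forall>A\<in>sets M. emeasure M A = (SUP C\<in>{C. compact C \<and> C \<subseteq> A}. emeasure M C))"

definition unitary_character :: "('g::{topological_group_add} \<Rightarrow> complex) \<Rightarrow> bool" where
  "unitary_character \<mu> \<longleftrightarrow> continuous_on UNIV \<mu> \<and> (\<forall>x. norm (\<mu> x) = 1) \<and>
     (\<forall>x y. \<mu> (x + y) = \<mu> x * \<mu> y)"

definition K_central :: "'g::{topological_group_add} set \<Rightarrow> ('g \<Rightarrow> complex) \<Rightarrow> bool" where
  "K_central K f \<longleftrightarrow> (\<forall>k\<in>K. \<forall>x. f (k + x) = f (x + k))"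

definition C_K :: "'g::{topological_group_add} measure \<Rightarrow> ('g \<Rightarrow> complex) \<Rightarrow> 'g \<Rightarrow> complex" where
  "C_K M f x = (\<integral>k. f (k + x + - k) \<partial>M)"

definition KS :: "'g::{topological_group_add} measure \<Rightarrow> ('g \<Rightarrow> complex) \<Rightarrow> ('g \<Rightarrow> complex) \<Rightarrow> 'g \<Rightarrow> 'g \<Rightarrow> complex" where
  "KS M \<mu> f x y = (\<integral>k. f (x + k + y + - k) \<partial>M) + \<mu> y * (\<integral>k. f (x + k + - y + - k) \<partial>M)"

end

(* Write T(y) phi (x) for the integral of phi(x k y k^-1) over K and argue modulo bounded functions, so that
   the hypothesis reads (T(y) + mu(y) T(y^-1)) f ~ 2 g(y) f.  Since T(y) T(z) is the average over h in K of
   T(y h z h^-1), the operators T(y) generate an algebra with the involution T(y)* = mu(y) T(y^-1), and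
   (A + A* ) f is a multiple of f for each of its elements A.  With S = T(y) + T(y)* and C = T(z) - T(z)*
   the commutators [S, C], [[S, C], C] and the square C^2 are self-adjoint, hence scalar on f, and if f is
   unbounded this forces [S, C] f ~ 0.  Then (T(z) S + S T(z)* ) f ~ 4 g(z) g(y) f, whereas the hypothesis
   averaged over K makes the left-hand side twice the d'Alembert expression of g times f.
   If f is bounded and g is not, the hypothesis itself gives f = 0. *)

theory Submission
  imports Defs
begin

section \<open>Operators modulo bounded functions\<close>

lemma bounded_range_add:
  fixes \<phi> \<psi> :: "'a \<Rightarrow> complex"
  shows "bounded (range \<phi>) \<Longrightarrow> bounded (range \<psi>) \<Longrightarrow> bounded (range (\<lambda>x. \<phi> x + \<psi> x))"
  by (rule bounded_plus_comp)

lemma bounded_range_diff: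
  fixes \<phi> \<psi> :: "'a \<Rightarrow> complex"
  shows "bounded (range \<phi>) \<Longrightarrow> bounded (range \<psi>) \<Longrightarrow> bounded (range (\<lambda>x. \<phi> x - \<psi> x))"
  by (rule bounded_minus_comp)

lemma bounded_range_cmult:
  fixes \<phi> :: "'a \<Rightarrow> complex"
  assumes "bounded (range \<phi>)"
  shows "bounded (range (\<lambda>x. c * \<phi> x))"
proof -
  obtain B where "\<And>x. norm (\<phi> x) \<le> B" using assms by (auto simp: bounded_iff)
  then have "norm (c * \<phi> x) \<le> norm c * B" for x
    by (simp add: norm_mult mult_left_mono)
  then show ?thesis by (auto simp: bounded_iff)
qed

text \<open>Reduces a relation modulo bounded functions to one exact identity: the target is
  rewritten as a combination of differences already known to be bounded.\<close>

lemma bounded_range_cong: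
  fixes \<phi> \<psi> :: "'a \<Rightarrow> complex"
  shows "bounded (range \<phi>) \<Longrightarrow> (\<And>x. \<psi> x = \<phi> x) \<Longrightarrow> bounded (range \<psi>)"
  by simp

lemmas bounded_range_intros = bounded_range_add bounded_range_diff bounded_range_cmult

text \<open>Linearity is demanded only on continuous functions, where the averaging integrals exist.
  The three clauses together let \<open>S\<close> act on continuous functions modulo bounded
  ones.\<close>

definition linear_mod_bounded :: "(('a::topological_space \<Rightarrow> complex) \<Rightarrow> 'a \<Rightarrow> complex) \<Rightarrow> bool" where
  "linear_mod_bounded S \<longleftrightarrow>
     (\<forall>\<phi>. continuous_on UNIV \<phi> \<longrightarrow> continuous_on UNIV (S \<phi>)) \<and>
     (\<forall>\<phi> \<psi> c. continuous_on UNIV \<phi> \<longrightarrow> continuous_on UNIV \<psi> \<longrightarrow>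
        S (\<lambda>x. \<phi> x + c * \<psi> x) = (\<lambda>x. S \<phi> x + c * S \<psi> x)) \<and>
     (\<forall>\<phi>. continuous_on UNIV \<phi> \<longrightarrow> bounded (range \<phi>) \<longrightarrow> bounded (range (S \<phi>)))"

lemma
  assumes "linear_mod_bounded S"
  shows linear_mod_bounded_continuous: "continuous_on UNIV \<phi> \<Longrightarrow> continuous_on UNIV (S \<phi>)"
    and linear_mod_bounded_add: "continuous_on UNIV \<phi> \<Longrightarrow> continuous_on UNIV \<psi> \<Longrightarrow>
      S (\<lambda>x. \<phi> x + c * \<psi> x) = (\<lambda>x. S \<phi> x + c * S \<psi> x)"
    and linear_mod_bounded_bounded: "continuous_on UNIV \<phi> \<Longrightarrow> bounded (range \<phi>) \<Longrightarrow> bounded (range (S \<phi>))"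
  using assms unfolding linear_mod_bounded_def by blast+

text \<open>The passage to the quotient by bounded functions: an operator may be applied to both
  sides of a relation \<phi> ~ c \<psi>.\<close>

lemma linear_mod_bounded_bounded_diff:
  assumes S: "linear_mod_bounded S" and \<phi>: "continuous_on UNIV \<phi>" and \<psi>: "continuous_on UNIV \<psi>"
    and "bounded (range (\<lambda>x. \<phi> x - c * \<psi> x))"
  shows "bounded (range (\<lambda>x. S \<phi> x - c * S \<psi> x))"
proof -
  have "bounded (range (S (\<lambda>x. \<phi> x + (- c) * \<psi> x)))"
    using assms(4) by (intro linear_mod_bounded_bounded[OF S] continuous_intros \<phi> \<psi>) simp
  then show ?thesis
    unfolding linear_mod_bounded_add[OF S \<phi> \<psi>] by simp
qed

text \<open>Modulo bounded functions, \<open>f\<close> is an eigenvector of \<open>S\<close>, of \<open>C\<^sup>2\<close>, of \<open>D = [S, C]\<close> and of \<open>[D, C]\<close>.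
  Evaluating \<open>(S - \<sigma>) C\<^sup>2 f\<close> in two ways gives \<open>2 \<gamma> C f + \<gamma>' f \<approx> 0\<close>, so \<open>\<gamma> \<noteq> 0\<close> would make \<open>f\<close>
  an eigenvector of \<open>C\<close> as well, and then \<open>D f \<approx> 0\<close>.\<close>

lemma commutator_eigenvalue_zero:
  assumes S: "linear_mod_bounded S" and C: "linear_mod_bounded C"
    and f: "continuous_on UNIV f" and unbounded: "\<not> bounded (range f)"
    and Sf: "bounded (range (\<lambda>x. S f x - \<sigma> * f x))"
    and D: "bounded (range (\<lambda>x. S (C f) x - C (S f) x - \<gamma> * f x))"
    and CC: "bounded (range (\<lambda>x. C (C f) x - \<kappa> * f x))"
    and DC: "bounded (range (\<lambda>x. S (C (C f)) x + C (C (S f)) x - 2 * C (S (C f)) x - \<gamma>' * f x))"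
  shows "\<gamma> = 0"
proof (rule ccontr)
  assume "\<gamma> \<noteq> 0"
  note cont = linear_mod_bounded_continuous[OF S] linear_mod_bounded_continuous[OF C] f
  have CS: "bounded (range (\<lambda>x. C (S f) x - \<sigma> * C f x))"
    by (intro linear_mod_bounded_bounded_diff[OF C] cont Sf)
  have CCS: "bounded (range (\<lambda>x. C (C (S f)) x - \<sigma> * C (C f) x))"
    by (intro linear_mod_bounded_bounded_diff[OF C] cont CS)
  have SCC: "bounded (range (\<lambda>x. S (C (C f)) x - \<kappa> * S f x))"
    by (intro linear_mod_bounded_bounded_diff[OF S] cont CC)
  have SC: "bounded (range (\<lambda>x. S (C f) x - \<gamma> * f x - \<sigma> * C f x))"
    by (rule bounded_range_cong[OF bounded_range_add[OF D CS]]) simp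
  \<comment> \<open>\<open>C\<close> is applied to the relation S C f ~ \<gamma> f + \<sigma> C
    f.\<close>
  have CSC: "bounded (range (\<lambda>x. C (S (C f)) x - \<gamma> * C f x - \<sigma> * C (C f) x))"
  proof -
    have "C (\<lambda>x. S (C f) x + (- \<gamma>) * f x) = (\<lambda>x. C (S (C f)) x + (- \<gamma>) * C f x)"
      by (intro linear_mod_bounded_add[OF C] cont)
    moreover have "bounded (range (\<lambda>x. C (\<lambda>x. S (C f) x + (- \<gamma>) * f x) x - \<sigma> * C (C f) x))"
      using SC by (intro linear_mod_bounded_bounded_diff[OF C] cont continuous_intros) simp
    ultimately show ?thesis by simp
  qed
  \<comment> \<open>In S C C f + C C S f - 2 C S C f ~ \<gamma>' f the first two terms and the part
    \<sigma> C C f of the third reduce to multiples of f and cancel, since C C f ~ \<kappa> f. What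
    is left is -2 \<gamma> C f ~ \<gamma>' f.\<close>
  have Cf: "bounded (range (\<lambda>x. C f x - (- \<gamma>' / (2 * \<gamma>)) * f x))"
  proof (rule bounded_range_cong)
    let ?DC = "\<lambda>x. S (C (C f)) x + C (C (S f)) x - 2 * C (S (C f)) x - \<gamma>' * f x"
    let ?CSC = "\<lambda>x. C (S (C f)) x - \<gamma> * C f x - \<sigma> * C (C f) x"
    show "bounded (range (\<lambda>x. (1 / (2 * \<gamma>)) * ((S (C (C f)) x - \<kappa> * S f x) + \<kappa> * (S f x - \<sigma> * f x)
        - 2 * ?CSC x + (C (C (S f)) x - \<sigma> * C (C f) x) - ?DC x - \<sigma> * (C (C f) x - \<kappa> * f x))))"
      by (intro bounded_range_intros SCC Sf CSC CCS DC CC)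
    show "C f x - (- \<gamma>' / (2 * \<gamma>)) * f x =
      (1 / (2 * \<gamma>)) * ((S (C (C f)) x - \<kappa> * S f x) + \<kappa> * (S f x - \<sigma> * f x)
        - 2 * ?CSC x + (C (C (S f)) x - \<sigma> * C (C f) x) - ?DC x - \<sigma> * (C (C f) x - \<kappa> * f x))" for x
      using \<open>\<gamma> \<noteq> 0\<close> by (simp add: field_simps)
  qed
  define l where "l = - \<gamma>' / (2 * \<gamma>)"
  note Cf = Cf[folded l_def]
  have SC': "bounded (range (\<lambda>x. S (C f) x - l * S f x))"
    by (intro linear_mod_bounded_bounded_diff[OF S] cont Cf)
  \<comment> \<open>S C f is computed twice: as l S f ~ l \<sigma> f, and as \<gamma> f + \<sigma> C
    f ~ \<gamma> f + \<sigma> l f. The difference is \<gamma> f.\<close>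
  have "bounded (range (\<lambda>x. (1 / \<gamma>) * ((S (C f) x - l * S f x) - (S (C f) x - \<gamma> * f x - \<sigma> * C f x)
      + l * (S f x - \<sigma> * f x) - \<sigma> * (C f x - l * f x))))"
    by (intro bounded_range_intros SC SC' Sf Cf)
  then have "bounded (range f)"
    by (rule bounded_range_cong) (use \<open>\<gamma> \<noteq> 0\<close> in \<open>simp add: field_simps\<close>)
  with unbounded show False ..
qed

section \<open>Haar integration on a compact subgroup\<close>

locale haar_compact_subgroup =
  fixes K :: "'g::{topological_group_add, t2_space} set" and M :: "'g measure"
  assumes subgroup: "compact_subgroup K" and haar: "normalized_haar K M"
begin

sublocale prob_space M
  using haar by (simp add: normalized_haar_def)

lemma compact_K: "compact K"
  and add_in_K: "a \<in> K \<Longrightarrow> b \<in> K \<Longrightarrow> a + b \<in> K"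
  and minus_in_K: "a \<in> K \<Longrightarrow> - a \<in> K"
  using subgroup by (auto simp: compact_subgroup_def)

lemma space_M: "space M = K" and sets_M: "sets M = sets (restrict_space borel K)"
  using haar by (auto simp: normalized_haar_def)

section \<open>Integrals of continuous functions and left invariance\<close>

lemma measurable_continuous:
  fixes \<phi> :: "'g \<Rightarrow> complex"
  assumes "continuous_on UNIV \<phi>"
  shows "\<phi> \<in> borel_measurable M"
  using measurable_restrict_space1[OF borel_measurable_continuous_onI[OF assms], of K]
  by (simp add: measurable_def space_M space_restrict_space sets_M)

lemma integrable_continuous:
  fixes \<phi> :: "'g \<Rightarrow> complex"
  assumes "continuous_on UNIV \<phi>"
  shows "integrable M \<phi>"
proof -
  have "compact (\<phi> ` K)"
    using assms compact_K by (meson compact_continuous_image continuous_on_subset subset_UNIV)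
  then obtain B where "\<And>k. k \<in> K \<Longrightarrow> norm (\<phi> k) \<le> B"
    by (meson bounded_iff compact_imp_bounded imageI)
  then show ?thesis
    using measurable_continuous[OF assms]
    by (intro integrable_const_bound[where B = B]) (auto simp: space_M)
qed

lemma norm_integral_le_const:
  fixes \<phi> :: "'g \<Rightarrow> complex"
  assumes "integrable M \<phi>" and "\<And>k. k \<in> K \<Longrightarrow> norm (\<phi> k) \<le> B"
  shows "norm (\<integral>k. \<phi> k \<partial>M) \<le> B"
proof -
  have "norm (\<integral>k. \<phi> k \<partial>M) \<le> (\<integral>k. norm (\<phi> k) \<partial>M)"
    by (rule integral_norm_bound)
  also have "\<dots> \<le> (\<integral>k. B \<partial>M)"
    using assms by (intro integral_mono) (auto simp: space_M)
  finally show ?thesis by (simp add: prob_space)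
qed

lemma integral_left_translate:
  fixes \<phi> :: "'g \<Rightarrow> complex"
  assumes "a \<in> K" and "continuous_on UNIV \<phi>"
  shows "(\<integral>k. \<phi> (a + k) \<partial>M) = (\<integral>k. \<phi> k \<partial>M)"
proof -
  have meas: "(\<lambda>k. a + k) \<in> measurable M M"
  proof -
    have "(\<lambda>k. a + k) \<in> borel_measurable borel"
      by (intro borel_measurable_continuous_onI continuous_intros)
    then have "(\<lambda>k. a + k) \<in> measurable (restrict_space borel K) (restrict_space borel K)"
      using assms(1) add_in_K
      by (intro measurable_restrict_space3) auto
    then show ?thesis
      by (simp add: measurable_def space_M space_restrict_space sets_M)
  qed
  have "distr M M (\<lambda>k. a + k) = M"
  proof (rule measure_eqI)
    fix A assume "A \<in> sets (distr M M (\<lambda>k. a + k))"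
    then have A: "A \<in> sets M" by simp
    then have "A \<subseteq> K" using sets.sets_into_space space_M by blast
    \<comment> \<open>Invariance is given for images of sets, while \<open>distr\<close> uses
      preimages; the preimage under translation by a is the image under translation by -a.\<close>
    have "(\<lambda>k. a + k) -` A \<inter> space M = (\<lambda>k. - a + k) ` A" (is "?L = ?R")
    proof
      show "?L \<subseteq> ?R"
      proof
        fix x assume "x \<in> ?L"
        then show "x \<in> ?R" by (intro image_eqI[where x = "a + x"]) auto
      qed
      show "?R \<subseteq> ?L"
        using \<open>A \<subseteq> K\<close> assms(1) add_in_K minus_in_K by (auto simp: space_M)
    qed
    moreover have "emeasure M ((\<lambda>k. - a + k) ` A) = emeasure M A"
      using haar A minus_in_K[OF assms(1)] by (simp add: normalized_haar_def)
    ultimately show "emeasure (distr M M (\<lambda>k. a + k)) A = emeasure M A"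
      using meas A by (simp add: emeasure_distr)
  qed simp
  then show ?thesis
    using integral_distr[OF meas measurable_continuous[OF assms(2)]] by simp
qed

section \<open>Continuity of parameter integrals and interchange of integrations\<close>

lemma uniform_on_K:
  fixes F :: "'a::topological_space \<Rightarrow> 'g \<Rightarrow> complex"
  assumes "continuous_on UNIV (\<lambda>p. F (fst p) (snd p))" and "e > 0"
  obtains X where "x0 \<in> X" "open X" "\<And>x k. x \<in> X \<Longrightarrow> k \<in> K \<Longrightarrow> dist (F x k) (F x0 k) \<le> e"
proof -
  have "continuous_on (UNIV \<times> K) (\<lambda>p. F (fst p) (snd p))"
    using assms(1) continuous_on_subset by blast
  \<comment> \<open>Compactness of K provides one neighbourhood of \<open>x0\<close> that serves all
    k at once.\<close>
  then obtain X where "x0 \<in> X" "open X"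
      "\<forall>x\<in>X \<inter> UNIV. \<forall>k\<in>K. dist (F (fst (x, k)) (snd (x, k))) (F (fst (x0, k)) (snd (x0, k))) \<le> e"
    using continuous_on_prod_compactE[OF _ compact_K UNIV_I assms(2)] by blast
  then show thesis by (intro that[of X]) simp_all
qed

lemma continuous_integral:
  fixes F :: "'a::topological_space \<Rightarrow> 'g \<Rightarrow> complex"
  assumes "continuous_on UNIV (\<lambda>p. F (fst p) (snd p))"
  shows "continuous_on UNIV (\<lambda>x. \<integral>k. F x k \<partial>M)"
proof -
  have int: "integrable M (F x)" for x
    by (rule integrable_continuous)
      (rule continuous_on_compose2[OF assms, of _ "\<lambda>k. (x, k)", simplified], intro continuous_intros)
  have "((\<lambda>x. \<integral>k. F x k \<partial>M) \<longlongrightarrow> (\<integral>k. F x0 k \<partial>M)) (at x0)" for x0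
  proof (rule tendstoI)
    fix e :: real assume "e > 0"
    \<comment> \<open>The bound \<open>e / 2\<close> leaves room for the strict inequality required
      of a limit.\<close>
    then obtain X where X: "x0 \<in> X" "open X"
        "\<And>x k. x \<in> X \<Longrightarrow> k \<in> K \<Longrightarrow> dist (F x k) (F x0 k) \<le> e / 2"
      using uniform_on_K[OF assms half_gt_zero, of e x0] by auto
    have "dist (\<integral>k. F x k \<partial>M) (\<integral>k. F x0 k \<partial>M) < e" if "x \<in> X" for x
    proof -
      have "norm (\<integral>k. F x k - F x0 k \<partial>M) \<le> e / 2"
        using X(3) that by (intro norm_integral_le_const Bochner_Integration.integrable_diff int) (auto simp: dist_norm)
      then show ?thesis using int \<open>e > 0\<close> by (simp add: dist_norm)
    qed
    then show "\<forall>\<^sub>F x in at x0. dist (\<integral>k. F x k \<partial>M) (\<integral>k. F x0 k \<partial>M) < e"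
      using X(1,2) by (auto simp: eventually_at_topological)
  qed
  then show ?thesis by (simp add: continuous_on_def)
qed

text \<open>The Borel sets of \<open>K \<times> K\<close> need not lie in the product \<open>\<sigma>\<close>-algebra, so the library version of
  Fubini's theorem does not apply; one integrates step functions over a finite Borel partition instead.\<close>

lemma integral_swap:
  fixes F :: "'g \<Rightarrow> 'g \<Rightarrow> complex"
  assumes F: "continuous_on UNIV (\<lambda>p. F (fst p) (snd p))"
  shows "(\<integral>h. \<integral>k. F h k \<partial>M \<partial>M) = (\<integral>k. \<integral>h. F h k \<partial>M \<partial>M)" (is "?L = ?R")
proof -
  have cont1: "continuous_on UNIV (F h)" for h
    by (rule continuous_on_compose2[OF F, of _ "\<lambda>k. (h, k)", simplified], intro continuous_intros)
  have cont2: "continuous_on UNIV (\<lambda>h. F h k)" for k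
    by (rule continuous_on_compose2[OF F, of _ "\<lambda>h. (h, k)", simplified], intro continuous_intros)
  have F': "continuous_on UNIV (\<lambda>p. F (snd p) (fst p))"
    by (rule continuous_on_compose2[OF F, of _ "\<lambda>p. (snd p, fst p)", simplified], intro continuous_intros)
  note int = integrable_continuous[OF cont1] integrable_continuous[OF cont2]
    integrable_continuous[OF continuous_integral[OF F]]
    integrable_continuous[OF continuous_integral[OF F']]
  have "dist ?L ?R \<le> e" if "e > 0" for e :: real
  proof -
    \<comment> \<open>On a small open set around h the function F varies by at most
      \<open>e / 2\<close>, uniformly in k; finitely many such sets cover K.\<close>
    have "\<exists>X. h \<in> X \<and> open X \<and> (\<forall>x\<in>X. \<forall>k\<in>K. dist (F x k) (F h k) \<le> e / 2)" for h
    proof -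
      have "e / 2 > 0" using that by simp
      from uniform_on_K[OF F this, of h] show ?thesis by (metis (no_types))
    qed
    then obtain X where X: "\<And>h. h \<in> X h" "\<And>h. open (X h)"
        "\<And>h x k. x \<in> X h \<Longrightarrow> k \<in> K \<Longrightarrow> dist (F x k) (F h k) \<le> e / 2"
      by metis
    obtain I where I: "I \<subseteq> K" "finite I" "K \<subseteq> (\<Union>h\<in>I. X h)"
      using compactE_image[OF compact_K, of K X] X(1,2) by blast
    obtain hs where hs: "set hs = I"
      using finite_list[OF I(2)] by blast
    define n where "n = length hs"
    \<comment> \<open>The cover is made disjoint by removing from each set its predecessors in the
      list. The pieces are Borel, so their measures can serve as weights.\<close>
    define A where "A i = (X (hs ! i) - (\<Union>j<i. X (hs ! j))) \<inter> K" for i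
    have A_sets: "A i \<in> sets M" for i
    proof -
      have "X (hs ! i) - (\<Union>j<i. X (hs ! j)) \<in> sets borel"
        using X(2) by (intro sets.Diff borel_open open_UN) auto
      then show ?thesis
        unfolding A_def sets_M sets_restrict_space by (subst Int_commute) (rule imageI)
    qed
    have A_cover: "\<exists>i<n. h \<in> A i" if "h \<in> K" for h
    proof -
      obtain j where "j < n" "h \<in> X (hs ! j)"
        using subsetD[OF I(3) \<open>h \<in> K\<close>] unfolding hs[symmetric] n_def by (auto simp: in_set_conv_nth)
      define l where "l = (LEAST i. h \<in> X (hs ! i))"
      have "h \<in> X (hs ! l)" "l \<le> j"
        unfolding l_def using \<open>h \<in> X (hs ! j)\<close>
        by (simp_all add: LeastI[of "\<lambda>i. h \<in> X (hs ! i)"] Least_le)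
      moreover have "h \<notin> X (hs ! i)" if "i < l" for i
        using that not_less_Least unfolding l_def by blast
      ultimately show ?thesis
        using that \<open>j < n\<close> by (intro exI[of _ l]) (auto simp: A_def)
    qed
    have A_disj: "i = j" if "h \<in> A i" "h \<in> A j" for h i j
      using that by (cases i j rule: linorder_cases) (auto simp: A_def)
    \<comment> \<open>The step function with value \<open>c i\<close> on \<open>A i\<close>.
      Replacing F h k by F at the chosen point \<open>hs ! i\<close> of the cover turns the integral
      over h into a finite sum.\<close>
    define St :: "(nat \<Rightarrow> complex) \<Rightarrow> 'g \<Rightarrow> complex"
      where "St c h = (\<Sum>i<n. indicator (A i) h *\<^sub>R c i)" for c h
    have step: "St c h = c i" if "h \<in> A i" "i < n" for h i and c :: "nat \<Rightarrow> complex"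
    proof -
      have "(\<Sum>j<n. indicator (A j) h *\<^sub>R c j) = (\<Sum>j<n. if j = i then c j else 0)"
        using A_disj that(1) by (intro sum.cong) (auto simp: indicator_def)
      then show ?thesis using that(2) by (simp add: St_def)
    qed
    have int_ind: "integrable M (indicat_real (A i))" for i
      using A_sets by (intro integrable_real_indicator) (auto simp: less_top[symmetric])
    have int_step: "integrable M (\<lambda>h. St c h)" for c :: "nat \<Rightarrow> complex"
      unfolding St_def by (intro Bochner_Integration.integrable_sum integrable_scaleR_left int_ind)
    have integral_step: "(\<integral>h. St c h \<partial>M) = (\<Sum>i<n. measure M (A i) *\<^sub>R c i)"
      for c :: "nat \<Rightarrow> complex"
    proof -
      have "A i \<inter> space M = A i" for i
        using sets.sets_into_space[OF A_sets] by (rule Int_absorb2)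
      then show ?thesis
        unfolding St_def by (subst Bochner_Integration.integral_sum) (simp_all add: int_ind)
    qed
    \<comment> \<open>Both iterated integrals lie within \<open>e / 2\<close> of the sum of
      \<open>measure M (A i) *\<^sub>R J i\<close>, because a finite sum may be exchanged with the
      integral over k.\<close>
    define J where "J i = (\<integral>k. F (hs ! i) k \<partial>M)" for i
    have close: "norm (F h k - F (hs ! i) k) \<le> e / 2" if "h \<in> A i" "k \<in> K" for h i k
      using X(3)[of h "hs ! i" k] that by (auto simp: A_def dist_norm)
    have "norm (\<integral>h. (\<integral>k. F h k \<partial>M) - St J h \<partial>M) \<le> e / 2"
    proof (intro norm_integral_le_const Bochner_Integration.integrable_diff int int_step)
      fix h assume "h \<in> K"
      then obtain i where i: "i < n" "h \<in> A i" using A_cover by blast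
      have "norm (\<integral>k. F h k - F (hs ! i) k \<partial>M) \<le> e / 2"
        using close[OF i(2)] by (intro norm_integral_le_const Bochner_Integration.integrable_diff int) auto
      then show "norm ((\<integral>k. F h k \<partial>M) - St J h) \<le> e / 2"
        by (simp add: step[OF i(2,1)] J_def int)
    qed
    then have 1: "norm (?L - (\<Sum>i<n. measure M (A i) *\<^sub>R J i)) \<le> e / 2"
      by (simp add: int int_step integral_step)
    have "norm (\<integral>k. (\<integral>h. F h k \<partial>M) - (\<Sum>i<n. measure M (A i) *\<^sub>R F (hs ! i) k) \<partial>M) \<le> e / 2"
    proof (intro norm_integral_le_const Bochner_Integration.integrable_diff int
        Bochner_Integration.integrable_sum integrable_scaleR_right)
      fix k assume k: "k \<in> K"
      have "norm (\<integral>h. F h k - St (\<lambda>i. F (hs ! i) k) h \<partial>M) \<le> e / 2"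
      proof (intro norm_integral_le_const Bochner_Integration.integrable_diff int int_step)
        fix h assume "h \<in> K"
        then obtain i where i: "i < n" "h \<in> A i" using A_cover by blast
        then show "norm (F h k - St (\<lambda>i. F (hs ! i) k) h) \<le> e / 2"
          using close k by (simp add: step[OF i(2,1)])
      qed
      then show "norm ((\<integral>h. F h k \<partial>M) - (\<Sum>i<n. measure M (A i) *\<^sub>R F (hs ! i) k)) \<le> e / 2"
        by (simp add: int int_step integral_step)
    qed
    then have 2: "norm (?R - (\<Sum>i<n. measure M (A i) *\<^sub>R J i)) \<le> e / 2"
      by (simp add: int J_def)
    show ?thesis
      using 1 2 norm_triangle_ineq4[of "?L - (\<Sum>i<n. measure M (A i) *\<^sub>R J i)" "?R - (\<Sum>i<n. measure M (A i) *\<^sub>R J i)"]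
      by (simp add: dist_norm)
  qed
  then show ?thesis
    using field_le_epsilon[of "dist ?L ?R" 0] by simp
qed

text \<open>The double integral of \<phi>(-k + h) is evaluated in both orders. For fixed h,
  replacing k by h + k leaves the integral of \<phi>(-k); for fixed k, left invariance in h leaves
  the integral of \<phi>(h).\<close>

lemma integral_minus:
  fixes \<phi> :: "'g \<Rightarrow> complex"
  assumes \<phi>: "continuous_on UNIV \<phi>"
  shows "(\<integral>k. \<phi> (- k) \<partial>M) = (\<integral>k. \<phi> k \<partial>M)"
proof -
  have "(\<integral>k. \<phi> (- k) \<partial>M) = (\<integral>h. \<integral>k. \<phi> (- k + h) \<partial>M \<partial>M)"
  proof -
    have "(\<integral>k. \<phi> (- k + h) \<partial>M) = (\<integral>k. \<phi> (- k) \<partial>M)" if "h \<in> K" for h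
    proof -
      have "continuous_on UNIV (\<lambda>k. \<phi> (- k + h))"
        by (intro continuous_on_compose2[OF \<phi>] continuous_intros) auto
      from integral_left_translate[OF that this] show ?thesis
        by (simp add: minus_add add.assoc)
    qed
    then have "(\<integral>h. \<integral>k. \<phi> (- k + h) \<partial>M \<partial>M) = (\<integral>h. \<integral>k. \<phi> (- k) \<partial>M \<partial>M)"
      by - (rule Bochner_Integration.integral_cong[OF refl], simp add: space_M)
    then show ?thesis by (simp add: prob_space)
  qed
  also have "\<dots> = (\<integral>k. \<integral>h. \<phi> (- k + h) \<partial>M \<partial>M)"
    by (rule integral_swap) (intro continuous_on_compose2[OF \<phi>] continuous_intros, auto)
  also have "\<dots> = (\<integral>k. \<integral>h. \<phi> h \<partial>M \<partial>M)"
    using integral_left_translate[OF minus_in_K \<phi>]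
    by - (rule Bochner_Integration.integral_cong[OF refl], simp add: space_M)
  finally show ?thesis by (simp add: prob_space)
qed

text \<open>Inversion turns right translation into left translation, as k + a = -(-a + -k).\<close>

lemma integral_right_translate:
  fixes \<phi> :: "'g \<Rightarrow> complex"
  assumes "a \<in> K" and \<phi>: "continuous_on UNIV \<phi>"
  shows "(\<integral>k. \<phi> (k + a) \<partial>M) = (\<integral>k. \<phi> k \<partial>M)"
proof -
  have cont: "continuous_on UNIV (\<lambda>k. \<phi> (k + a))" "continuous_on UNIV (\<lambda>k. \<phi> (- k))"
    by (intro continuous_on_compose2[OF \<phi>] continuous_intros; auto)+
  have "(\<integral>k. \<phi> (k + a) \<partial>M) = (\<integral>k. \<phi> (- (- a + k)) \<partial>M)"
    using integral_minus[OF cont(1)] by (simp add: minus_add)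
  also have "\<dots> = (\<integral>k. \<phi> k \<partial>M)"
    using integral_left_translate[OF minus_in_K[OF assms(1)] cont(2)] integral_minus[OF \<phi>] by simp
  finally show ?thesis .
qed

section \<open>The averaging operators T(y), written \<open>avg y\<close>, and their
  products\<close>

definition avg :: "'g \<Rightarrow> ('g \<Rightarrow> complex) \<Rightarrow> 'g \<Rightarrow> complex" where
  "avg y \<phi> x = (\<integral>k. \<phi> (x + k + y + - k) \<partial>M)"

lemma KS_eq_avg: "KS M \<mu> \<phi> x y = avg y \<phi> x + \<mu> y * avg (- y) \<phi> x"
  by (simp add: KS_def avg_def)

text \<open>The averaged function may depend on the parameter too; products of three operators
  require this, where T(-w) acts on a family of functions indexed by h.\<close>

lemma continuous_avg_param:
  fixes \<Phi> :: "'a::topological_space \<Rightarrow> 'g \<Rightarrow> complex"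
  assumes \<Phi>: "continuous_on UNIV (\<lambda>p. \<Phi> (fst p) (snd p))"
    and a: "continuous_on UNIV a" and b: "continuous_on UNIV b"
  shows "continuous_on UNIV (\<lambda>p. avg (a p) (\<Phi> p) (b p))"
  unfolding avg_def
proof (rule continuous_integral)
  have "continuous_on UNIV (\<lambda>p. (fst p, b (fst p) + snd p + a (fst p) + - snd p) :: 'a \<times> 'g)"
    by (intro continuous_intros continuous_on_compose2[OF a] continuous_on_compose2[OF b]) auto
  from continuous_on_compose2[OF \<Phi> this]
  show "continuous_on UNIV (\<lambda>p. \<Phi> (fst p) (b (fst p) + snd p + a (fst p) + - snd p))"
    by simp
qed

lemma continuous_avg:
  assumes \<phi>: "continuous_on UNIV \<phi>" and "continuous_on UNIV a" and "continuous_on UNIV b"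
  shows "continuous_on UNIV (\<lambda>p. avg (a p) \<phi> (b p))"
  using assms by (intro continuous_avg_param continuous_on_compose2[OF \<phi>] continuous_intros) auto

lemma integrable_avg:
  assumes "continuous_on UNIV \<phi>" and "continuous_on UNIV a" and "continuous_on UNIV b"
  shows "integrable M (\<lambda>p. avg (a p) \<phi> (b p))"
  using assms by (intro integrable_continuous continuous_avg)

lemma avg_linear:
  assumes \<phi>: "continuous_on UNIV \<phi>" and \<psi>: "continuous_on UNIV \<psi>"
  shows "avg y (\<lambda>x. \<phi> x + c * \<psi> x) = (\<lambda>x. avg y \<phi> x + c * avg y \<psi> x)"
proof
  fix x
  have "integrable M (\<lambda>k. \<phi> (x + k + y + - k))" "integrable M (\<lambda>k. \<psi> (x + k + y + - k))"
    by (intro integrable_continuous continuous_on_compose2[OF \<phi>] continuous_on_compose2[OF \<psi>]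
        continuous_intros; auto)+
  then show "avg y (\<lambda>x. \<phi> x + c * \<psi> x) x = avg y \<phi> x + c * avg y \<psi> x"
    unfolding avg_def by simp
qed

lemma norm_avg_le:
  assumes \<phi>: "continuous_on UNIV \<phi>" and "\<And>x. norm (\<phi> x) \<le> B"
  shows "norm (avg y \<phi> x) \<le> B"
  unfolding avg_def using assms(2)
  by (intro norm_integral_le_const integrable_continuous continuous_on_compose2[OF \<phi>] continuous_intros) auto

text \<open>Conjugation by h replaces k by k + h under the integral, which right invariance
  absorbs.\<close>

lemma avg_conj:
  assumes \<phi>: "continuous_on UNIV \<phi>" and "h \<in> K"
  shows "avg (h + y + - h) \<phi> x = avg y \<phi> x"
proof -
  have "continuous_on UNIV (\<lambda>k. \<phi> (x + k + y + - k))"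
    by (intro continuous_on_compose2[OF \<phi>] continuous_intros) auto
  from integral_right_translate[OF assms(2) this] show ?thesis
    by (simp add: avg_def minus_add add.assoc del: add_uminus_conv_diff)
qed

text \<open>The product formula for T(y) T(z). Translating the inner variable by k moves the inner
  -k to the far right, so that after interchanging the integrals the outer one is again an average
  by conjugation.\<close>

lemma avg_avg:
  assumes \<phi>: "continuous_on UNIV \<phi>"
  shows "avg y (avg z \<phi>) x = (\<integral>h. avg (y + h + z + - h) \<phi> x \<partial>M)"
proof -
  have "avg y (avg z \<phi>) x = (\<integral>k. \<integral>h. \<phi> (x + k + y + - k + h + z + - h) \<partial>M \<partial>M)"
    by (simp add: avg_def)
  also have "\<dots> = (\<integral>k. \<integral>h. \<phi> (x + k + (y + h + z + - h) + - k) \<partial>M \<partial>M)"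
  proof (rule Bochner_Integration.integral_cong[OF refl])
    fix k assume "k \<in> space M"
    then have "k \<in> K" by (simp add: space_M)
    have "continuous_on UNIV (\<lambda>h. \<phi> (x + k + y + - k + h + z + - h))"
      by (intro continuous_on_compose2[OF \<phi>] continuous_intros) auto
    \<comment> \<open>With k + h in place of h, the factor -k + (k + h) + z + -(k + h) becomes h + z
      + -h + -k.\<close>
    from integral_left_translate[OF \<open>k \<in> K\<close> this]
    show "(\<integral>h. \<phi> (x + k + y + - k + h + z + - h) \<partial>M) = (\<integral>h. \<phi> (x + k + (y + h + z + - h) + - k) \<partial>M)"
      by (simp add: minus_add add.assoc del: add_uminus_conv_diff)
  qed
  also have "\<dots> = (\<integral>h. \<integral>k. \<phi> (x + k + (y + h + z + - h) + - k) \<partial>M \<partial>M)"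
    by (rule integral_swap) (intro continuous_on_compose2[OF \<phi>] continuous_intros, auto)
  finally show ?thesis by (simp add: avg_def)
qed

text \<open>The reversed product of inverses averages over the inverses of the very elements that
  occur for T(y) T(z), which makes the involution reverse products. The product formula is followed
  by inversion of h and conjugation by h.\<close>

lemma avg_avg_minus:
  assumes \<phi>: "continuous_on UNIV \<phi>"
  shows "avg (- z) (avg (- y) \<phi>) x = (\<integral>h. avg (- (y + h + z + - h)) \<phi> x \<partial>M)"
proof -
  have "continuous_on UNIV (\<lambda>h. avg (- z + h + - y + - h) \<phi> x)"
    by (intro continuous_avg \<phi> continuous_intros)
  from integral_minus[OF this]
  have "avg (- z) (avg (- y) \<phi>) x = (\<integral>h. avg (- z + - h + - y + h) \<phi> x \<partial>M)"
    unfolding avg_avg[OF \<phi>] by simp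
  also have "\<dots> = (\<integral>h. avg (- (y + h + z + - h)) \<phi> x \<partial>M)"
  proof (rule Bochner_Integration.integral_cong[OF refl])
    fix h assume "h \<in> space M"
    then show "avg (- z + - h + - y + h) \<phi> x = avg (- (y + h + z + - h)) \<phi> x"
      using avg_conj[OF \<phi>, of h "- z + - h + - y + h" x]
      by (simp add: space_M minus_add add.assoc del: add_uminus_conv_diff)
  qed
  finally show ?thesis .
qed

text \<open>An instance of \<open>integral_swap\<close>, used to move T(-w) inside the average that
  represents T(-z) T(-y) f.\<close>

lemma avg_integral:
  fixes \<Phi> :: "'g \<Rightarrow> 'g \<Rightarrow> complex"
  assumes \<Phi>: "continuous_on UNIV (\<lambda>p. \<Phi> (fst p) (snd p))"
  shows "avg y (\<lambda>x. \<integral>h. \<Phi> h x \<partial>M) x = (\<integral>h. avg y (\<Phi> h) x \<partial>M)"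
proof -
  have "continuous_on UNIV (\<lambda>p. (snd p, x + fst p + y + - fst p) :: 'g \<times> 'g)"
    by (intro continuous_intros)
  from continuous_on_compose2[OF \<Phi> this] show ?thesis
    unfolding avg_def by (intro integral_swap) simp
qed

end

section \<open>The approximate Wilson equation\<close>

locale approximate_wilson = haar_compact_subgroup +
  fixes \<mu> f g :: "'a \<Rightarrow> complex" and \<delta> :: real
  assumes character: "unitary_character \<mu>"
    and f: "continuous_on UNIV f" and g: "continuous_on UNIV g"
    and approx: "norm (KS M \<mu> f x y - 2 * f x * g y) \<le> \<delta>"
begin

section \<open>Products of operators plus their adjoints, applied to f\<close>

lemma character_add: "\<mu> (x + y) = \<mu> x * \<mu> y"
  and character_nonzero: "\<mu> x \<noteq> 0"
  using character unfolding unitary_character_def by (auto, metis norm_zero zero_neq_one)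

lemma character_minus: "\<mu> (- x) = inverse (\<mu> x)"
proof -
  have "\<mu> 0 = 1"
    using character_add[of 0 0] character_nonzero[of 0] by simp
  then show ?thesis
    using character_add[of x "- x"] by (simp add: inverse_unique)
qed

text \<open>For A = T(y) T(z) this is A f + A* f. The involution reverses the factors, hence the
  order of -z and -y.\<close>

definition word2 :: "'a \<Rightarrow> 'a \<Rightarrow> 'a \<Rightarrow> complex" where
  "word2 y z x = avg y (avg z f) x + \<mu> y * \<mu> z * avg (- z) (avg (- y) f) x"

definition word3 :: "'a \<Rightarrow> 'a \<Rightarrow> 'a \<Rightarrow> 'a \<Rightarrow> complex" where
  "word3 y z w x = avg y (avg z (avg w f)) x
     + \<mu> y * \<mu> z * \<mu> w * avg (- w) (avg (- z) (avg (- y) f)) x"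

lemma approx_word1: "norm (avg y f x + \<mu> y * avg (- y) f x - 2 * f x * g y) \<le> \<delta>"
  using approx by (simp add: KS_eq_avg)

text \<open>Averaging the hypothesis at the elements y h z h^-1 over h in K gives the claim: \<mu>
  has the constant value \<mu>(y) \<mu>(z) there, and averaging does not increase the error
  bound.\<close>

lemma approx_word2: "norm (word2 y z x - 2 * f x * avg z g y) \<le> \<delta>"
proof -
  let ?w = "\<lambda>h. y + h + z + - h"
  have w: "continuous_on UNIV ?w" by (intro continuous_intros)
  have \<mu>: "\<mu> (?w h) = \<mu> y * \<mu> z" for h
    by (simp add: character_add character_minus character_nonzero del: add_uminus_conv_diff)
  have int: "integrable M (\<lambda>h. avg (?w h) f x)" "integrable M (\<lambda>h. avg (- ?w h) f x)"
      "integrable M (\<lambda>h. g (?w h))"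
    by (intro integrable_avg integrable_continuous continuous_on_compose2[OF g] f continuous_intros; auto)+
  have "word2 y z x - 2 * f x * avg z g y
      = (\<integral>h. avg (?w h) f x + \<mu> (?w h) * avg (- ?w h) f x - 2 * f x * g (?w h) \<partial>M)"
    using int unfolding word2_def avg_avg_minus[OF f] unfolding avg_avg[OF f] avg_def[of z g] \<mu>
    by (simp del: add_uminus_conv_diff)
  also have "norm \<dots> \<le> \<delta>"
    using int unfolding \<mu>
    by (intro norm_integral_le_const Bochner_Integration.integrable_add Bochner_Integration.integrable_diff
        integrable_mult_right approx_word1[of "?w _", unfolded \<mu>])
  finally show ?thesis .
qed

text \<open>The same averaging, now of the estimate for two operators with first element y h z h^-1
  and second element w.\<close>

lemma approx_word3: "norm (word3 y z w x - 2 * f x * (\<integral>h. avg w g (y + h + z + - h) \<partial>M)) \<le> \<delta>"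
proof -
  let ?w = "\<lambda>h. y + h + z + - h"
  have \<mu>: "\<mu> (?w h) = \<mu> y * \<mu> z" for h
    by (simp add: character_add character_minus character_nonzero del: add_uminus_conv_diff)
  have cont_avg: "continuous_on UNIV (avg w f)"
    by (intro continuous_avg f continuous_intros)
  have cont: "continuous_on UNIV (\<lambda>p. avg (- ?w (fst p)) f (snd p))"
    by (intro continuous_avg f continuous_intros)
  have int: "integrable M (\<lambda>h. avg (?w h) (avg w f) x)" "integrable M (\<lambda>h. avg (- w) (avg (- ?w h) f) x)"
      "integrable M (\<lambda>h. avg w g (?w h))"
  proof -
    show "integrable M (\<lambda>h. avg (?w h) (avg w f) x)" "integrable M (\<lambda>h. avg w g (?w h))"
      by (intro integrable_avg cont_avg f g continuous_intros)+
    show "integrable M (\<lambda>h. avg (- w) (avg (- ?w h) f) x)"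
      by (intro integrable_continuous continuous_avg_param cont continuous_intros)
  qed
  have "avg (- z) (avg (- y) f) = (\<lambda>x. \<integral>h. avg (- ?w h) f x \<partial>M)"
    \<comment> \<open>In the adjoint product the pair to be merged is the inner one, so the outer
      T(-w) still has to be taken inside the integral over h.\<close>
    using avg_avg_minus[OF f] by (rule ext)
  then have "avg (- w) (avg (- z) (avg (- y) f)) x = (\<integral>h. avg (- w) (avg (- ?w h) f) x \<partial>M)"
    by (simp only: avg_integral[OF cont])
  then have "word3 y z w x - 2 * f x * (\<integral>h. avg w g (?w h) \<partial>M)
      = (\<integral>h. avg (?w h) (avg w f) x + \<mu> (?w h) * \<mu> w * avg (- w) (avg (- ?w h) f) x
          - 2 * f x * avg w g (?w h) \<partial>M)"
    using int unfolding word3_def avg_avg[OF cont_avg] \<mu>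
    by (simp del: add_uminus_conv_diff)
  also have "norm \<dots> \<le> \<delta>"
    using int unfolding \<mu>
    by (intro norm_integral_le_const Bochner_Integration.integrable_add Bochner_Integration.integrable_diff
        integrable_mult_right approx_word2[of "?w _", unfolded word2_def \<mu>])
  finally show ?thesis .
qed

section \<open>Multiples of f modulo bounded functions\<close>

definition scalar_mod_bounded :: "('a \<Rightarrow> complex) \<Rightarrow> bool" where
  "scalar_mod_bounded \<phi> \<longleftrightarrow> (\<exists>c. bounded (range (\<lambda>x. \<phi> x - c * f x)))"

lemma scalar_mod_bounded_add:
  assumes "scalar_mod_bounded \<phi>" "scalar_mod_bounded \<psi>"
  shows "scalar_mod_bounded (\<lambda>x. \<phi> x + \<psi> x)"
proof -
  from assms obtain c d where "bounded (range (\<lambda>x. \<phi> x - c * f x))" "bounded (range (\<lambda>x. \<psi> x - d * f x))"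
    by (auto simp: scalar_mod_bounded_def)
  from bounded_range_add[OF this] have "bounded (range (\<lambda>x. \<phi> x + \<psi> x - (c + d) * f x))"
    by (rule bounded_range_cong) (simp add: algebra_simps)
  then show ?thesis by (auto simp: scalar_mod_bounded_def)
qed

lemma scalar_mod_bounded_cmult:
  assumes "scalar_mod_bounded \<phi>"
  shows "scalar_mod_bounded (\<lambda>x. a * \<phi> x)"
proof -
  from assms obtain c where "bounded (range (\<lambda>x. \<phi> x - c * f x))"
    by (auto simp: scalar_mod_bounded_def)
  from bounded_range_cmult[OF this, of a] have "bounded (range (\<lambda>x. a * \<phi> x - (a * c) * f x))"
    by (rule bounded_range_cong) (simp add: algebra_simps)
  then show ?thesis by (auto simp: scalar_mod_bounded_def)
qed

lemma scalar_mod_bounded_diff: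
  assumes "scalar_mod_bounded \<phi>" "scalar_mod_bounded \<psi>"
  shows "scalar_mod_bounded (\<lambda>x. \<phi> x - \<psi> x)"
  using scalar_mod_bounded_add[OF assms(1) scalar_mod_bounded_cmult[OF assms(2), of "- 1"]] by simp

lemma bounded_word2: "bounded (range (\<lambda>x. word2 y z x - 2 * avg z g y * f x))"
  using approx_word2[of y z] by (auto simp: bounded_iff ac_simps)

lemma scalar_word2: "scalar_mod_bounded (word2 y z)"
  using bounded_word2 by (auto simp: scalar_mod_bounded_def)

lemma scalar_word3: "scalar_mod_bounded (word3 y z w)"
proof -
  have "bounded (range (\<lambda>x. word3 y z w x - 2 * (\<integral>h. avg w g (y + h + z + - h) \<partial>M) * f x))"
    using approx_word3[of y z w] by (auto simp: bounded_iff ac_simps)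
  then show ?thesis by (auto simp: scalar_mod_bounded_def)
qed

lemmas scalar_intros = scalar_mod_bounded_add scalar_mod_bounded_diff scalar_mod_bounded_cmult
  scalar_word2 scalar_word3

section \<open>The operators T(y) + e T(y)*, with e = 1 for S and e = -1 for C\<close>

definition signed_avg :: "complex \<Rightarrow> 'a \<Rightarrow> ('a \<Rightarrow> complex) \<Rightarrow> 'a \<Rightarrow> complex" where
  "signed_avg e y \<phi> = (\<lambda>x. avg y \<phi> x + (e * \<mu> y) * avg (- y) \<phi> x)"

lemma linear_mod_bounded_avg: "linear_mod_bounded (avg y)"
  unfolding linear_mod_bounded_def
proof (intro conjI allI impI)
  fix \<phi> :: "'a \<Rightarrow> complex" assume \<phi>: "continuous_on UNIV \<phi>"
  show "continuous_on UNIV (avg y \<phi>)"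
    by (intro continuous_avg \<phi> continuous_intros)
  assume "bounded (range \<phi>)"
  then show "bounded (range (avg y \<phi>))"
    using norm_avg_le[OF \<phi>] by (auto simp: bounded_iff)
qed (rule avg_linear)

lemma avg_continuous: "continuous_on UNIV \<phi> \<Longrightarrow> continuous_on UNIV (avg y \<phi>)"
  by (rule linear_mod_bounded_continuous[OF linear_mod_bounded_avg])

lemma linear_mod_bounded_signed_avg: "linear_mod_bounded (signed_avg e y)"
  unfolding linear_mod_bounded_def
proof (intro conjI allI impI)
  fix \<phi> :: "'a \<Rightarrow> complex" assume \<phi>: "continuous_on UNIV \<phi>"
  show "continuous_on UNIV (signed_avg e y \<phi>)"
    unfolding signed_avg_def by (intro continuous_intros avg_continuous \<phi>)
  show "bounded (range (signed_avg e y \<phi>))" if "bounded (range \<phi>)"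
    unfolding signed_avg_def
    by (intro bounded_range_intros linear_mod_bounded_bounded[OF linear_mod_bounded_avg] \<phi> that)
  show "signed_avg e y (\<lambda>x. \<phi> x + c * \<psi> x) = (\<lambda>x. signed_avg e y \<phi> x + c * signed_avg e y \<psi> x)"
    if "continuous_on UNIV \<psi>" for \<psi> c
    unfolding signed_avg_def avg_linear[OF \<phi> that] by (simp add: algebra_simps)
qed

text \<open>Expansion into products of averaging operators, so that operator identities on f reduce
  to comparing coefficients.\<close>

lemma signed_avg_comp2:
  assumes "continuous_on UNIV \<phi>"
  shows "signed_avg e y (signed_avg d z \<phi>) = (\<lambda>x. avg y (avg z \<phi>) x + d * \<mu> z * avg y (avg (- z) \<phi>) x
    + e * \<mu> y * avg (- y) (avg z \<phi>) x + e * \<mu> y * d * \<mu> z * avg (- y) (avg (- z) \<phi>) x)"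
  unfolding signed_avg_def[of d] unfolding signed_avg_def
  unfolding avg_linear[OF avg_continuous[OF assms] avg_continuous[OF assms]]
  by (simp add: algebra_simps)

lemma signed_avg_comp3:
  assumes "continuous_on UNIV \<phi>"
  shows "signed_avg e y (signed_avg d z (signed_avg c w \<phi>)) x =
      avg y (avg z (avg w \<phi>)) x
    + c * \<mu> w * avg y (avg z (avg (- w) \<phi>)) x
    + d * \<mu> z * avg y (avg (- z) (avg w \<phi>)) x
    + d * \<mu> z * c * \<mu> w * avg y (avg (- z) (avg (- w) \<phi>)) x
    + e * \<mu> y * avg (- y) (avg z (avg w \<phi>)) x
    + e * \<mu> y * c * \<mu> w * avg (- y) (avg z (avg (- w) \<phi>)) x
    + e * \<mu> y * d * \<mu> z * avg (- y) (avg (- z) (avg w \<phi>)) x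
    + e * \<mu> y * d * \<mu> z * c * \<mu> w * avg (- y) (avg (- z) (avg (- w) \<phi>)) x"
proof -
  have lin: "avg u (signed_avg c w \<phi>) = (\<lambda>x. avg u (avg w \<phi>) x + (c * \<mu> w) * avg u (avg (- w) \<phi>) x)" for u
    unfolding signed_avg_def by (rule avg_linear) (intro avg_continuous assms)+
  have "avg v (avg u (signed_avg c w \<phi>)) = (\<lambda>x. avg v (avg u (avg w \<phi>)) x + (c * \<mu> w) * avg v (avg u (avg (- w) \<phi>)) x)" for u v
    unfolding lin by (rule avg_linear) (intro avg_continuous assms)+
  then show ?thesis
    by (subst signed_avg_comp2[OF linear_mod_bounded_continuous[OF linear_mod_bounded_signed_avg assms]]) (simp add: algebra_simps)
qed

section \<open>The commutator, and the functional equation for g\<close>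

lemma bounded_signed_avg: "bounded (range (\<lambda>x. signed_avg 1 y f x - 2 * g y * f x))"
  using approx_word1[of y] by (auto simp: signed_avg_def bounded_iff ac_simps)

text \<open>Since S* = S and C* = -C, the involution fixes D = [S, C], the square of C, and [D, C].
  Each is therefore a combination of terms A + A* and acts on f as a scalar modulo bounded
  functions; \<open>commutator_eigenvalue_zero\<close> then makes the scalar of D zero.\<close>

lemma commutator_bounded:
  assumes unbounded: "\<not> bounded (range f)"
  shows "bounded (range (\<lambda>x. signed_avg 1 y (signed_avg (-1) z f) x - signed_avg (-1) z (signed_avg 1 y f) x))"
proof -
  note nz = character_nonzero[of y] character_nonzero[of z]
  have "scalar_mod_bounded (\<lambda>x. signed_avg 1 y (signed_avg (-1) z f) x - signed_avg (-1) z (signed_avg 1 y f) x)"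
  proof -
    \<comment> \<open>The four products in S C are paired with their adjoints in -C S; the
      coefficients \<mu>(y) and \<mu>(z) turn T(-y) and T(-z) into T(y)* and T(z)*.\<close>
    have "scalar_mod_bounded (\<lambda>x. word2 y z x - \<mu> z * word2 y (- z) x + \<mu> y * word2 (- y) z x
        - (\<mu> y * \<mu> z) * word2 (- y) (- z) x)"
      by (intro scalar_intros)
    also have "(\<lambda>x. word2 y z x - \<mu> z * word2 y (- z) x + \<mu> y * word2 (- y) z x
        - (\<mu> y * \<mu> z) * word2 (- y) (- z) x) = (\<lambda>x. signed_avg 1 y (signed_avg (-1) z f) x - signed_avg (-1) z (signed_avg 1 y f) x)"
      using nz by (simp add: fun_eq_iff signed_avg_comp2[OF f] word2_def character_minus field_simps)
    finally show ?thesis .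
  qed
  then obtain \<gamma> where \<gamma>: "bounded (range (\<lambda>x. signed_avg 1 y (signed_avg (-1) z f) x - signed_avg (-1) z (signed_avg 1 y f) x - \<gamma> * f x))"
    by (auto simp: scalar_mod_bounded_def)
  have "scalar_mod_bounded (signed_avg (-1) z (signed_avg (-1) z f))"
  proof -
    \<comment> \<open>T(z) T(z)* and T(z)* T(z) are their own adjoints, so \<open>word2\<close>
      counts each of them twice; this explains the factor 1/2.\<close>
    have "scalar_mod_bounded (\<lambda>x. word2 z z x - (\<mu> z / 2) * (word2 z (- z) x + word2 (- z) z x))"
      by (intro scalar_intros)
    also have "(\<lambda>x. word2 z z x - (\<mu> z / 2) * (word2 z (- z) x + word2 (- z) z x)) = signed_avg (-1) z (signed_avg (-1) z f)"
      using nz by (simp add: fun_eq_iff signed_avg_comp2[OF f] word2_def character_minus field_simps)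
    finally show ?thesis .
  qed
  then obtain \<kappa> where \<kappa>: "bounded (range (\<lambda>x. signed_avg (-1) z (signed_avg (-1) z f) x - \<kappa> * f x))"
    by (auto simp: scalar_mod_bounded_def)
  let ?DC = "\<lambda>x. signed_avg 1 y (signed_avg (-1) z (signed_avg (-1) z f)) x + signed_avg (-1) z (signed_avg (-1) z (signed_avg 1 y f)) x
      - 2 * signed_avg (-1) z (signed_avg 1 y (signed_avg (-1) z f)) x"
  have "scalar_mod_bounded ?DC"
  proof -
    \<comment> \<open>C C S is the adjoint of S C C, so the eight products in S C C give eight full
      words. C S C is its own adjoint, and its eight products form only four pairs.\<close>
    let ?W = "\<lambda>x. word3 y z z x - \<mu> z * word3 y z (- z) x - \<mu> z * word3 y (- z) z x
        + (\<mu> z * \<mu> z) * word3 y (- z) (- z) x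
        + \<mu> y * (word3 (- y) z z x - \<mu> z * word3 (- y) z (- z) x - \<mu> z * word3 (- y) (- z) z x
        + (\<mu> z * \<mu> z) * word3 (- y) (- z) (- z) x)
        - 2 * (word3 z y z x + \<mu> y * word3 z (- y) z x - \<mu> z * word3 z y (- z) x - \<mu> z * word3 (- z) y z x)"
    have "scalar_mod_bounded ?W"
      by (intro scalar_intros)
    also have "?W = ?DC"
      using nz by (simp add: fun_eq_iff signed_avg_comp3[OF f] word3_def character_minus field_simps)
    finally show ?thesis .
  qed
  then obtain \<gamma>' where "bounded (range (\<lambda>x. ?DC x - \<gamma>' * f x))"
    by (auto simp: scalar_mod_bounded_def)
  from commutator_eigenvalue_zero[OF linear_mod_bounded_signed_avg linear_mod_bounded_signed_avg f unbounded bounded_signed_avg \<gamma> \<kappa> this]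
  show ?thesis using \<gamma> by simp
qed

lemma KS_eq_of_unbounded:
  assumes unbounded: "\<not> bounded (range f)"
  shows "KS M \<mu> g z y = 2 * g z * g y"
proof (rule ccontr)
  let ?S = "signed_avg 1 y" and ?D = "signed_avg 1 z" and ?C = "signed_avg (-1) z"
  note cont = linear_mod_bounded_continuous[OF linear_mod_bounded_signed_avg] avg_continuous f
  \<comment> \<open>The two words add up to T(z) S f + S T(z)* f, and the two scalars to twice the
    d'Alembert expression of g at z and y.\<close>
  have 1: "bounded (range (\<lambda>x. (word2 z y x - 2 * avg y g z * f x)
      + \<mu> y * (word2 z (- y) x - 2 * avg (- y) g z * f x)))"
    by (intro bounded_range_intros bounded_word2)
  have 2: "bounded (range (\<lambda>x. avg z (?S f) x - 2 * g y * avg z f x))"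
    by (intro linear_mod_bounded_bounded_diff[OF linear_mod_bounded_avg] cont bounded_signed_avg)
  have 3: "bounded (range (\<lambda>x. ?S (?D f) x - 2 * g z * ?S f x))"
    by (intro linear_mod_bounded_bounded_diff[OF linear_mod_bounded_signed_avg] cont bounded_signed_avg)
  have 4: "bounded (range (\<lambda>x. ?C (?S f) x - 2 * g y * ?C f x))"
    by (intro linear_mod_bounded_bounded_diff[OF linear_mod_bounded_signed_avg] cont bounded_signed_avg)
  assume neq: "KS M \<mu> g z y \<noteq> 2 * g z * g y"
  \<comment> \<open>With T(z)* = (D - C) / 2 for D = \<open>?D\<close>, the commutator bound gives S
    T(z)* f ~ 2 g(z) g(y) f - g(y) C f. Also T(z) S f ~ 2 g(y) T(z) f = g(y) D f + g(y) C f. The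
    terms in C f cancel in the sum, which is ~ 4 g(z) g(y) f.\<close>
  let ?R = "\<lambda>x. (avg z (?S f) x - 2 * g y * avg z f x)
      - ((word2 z y x - 2 * avg y g z * f x) + \<mu> y * (word2 z (- y) x - 2 * avg (- y) g z * f x))
      + (1 / 2) * (?S (?D f) x - 2 * g z * ?S f x) + g z * (?S f x - 2 * g y * f x)
      - (1 / 2) * (?S (?C f) x - ?C (?S f) x) - (1 / 2) * (?C (?S f) x - 2 * g y * ?C f x)
      + g y * (?D f x - 2 * g z * f x)"
  \<comment> \<open>\<open>?R\<close> is an exact multiple of f; when the equation fails, its
    coefficient is nonzero, and dividing by it would make f bounded.\<close>
  have "bounded (range (\<lambda>x. (1 / (2 * KS M \<mu> g z y - 4 * g z * g y)) * ?R x))"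
    by (intro bounded_range_intros 1 2 3 4 bounded_signed_avg commutator_bounded unbounded)
  moreover have "?R x = (2 * KS M \<mu> g z y - 4 * g z * g y) * f x" for x
  proof -
    have S: "avg z (?S f) x = avg z (avg y f) x + \<mu> y * avg z (avg (- y) f) x"
      using avg_linear[OF avg_continuous[OF f] avg_continuous[OF f], of z y "1 * \<mu> y" "- y"]
      by (simp add: signed_avg_def)
    show ?thesis
      using character_nonzero[of y]
      unfolding S signed_avg_comp2[OF f] word2_def KS_eq_avg character_minus
      unfolding signed_avg_def
      by (simp add: field_simps)
  qed
  ultimately have "bounded (range f)"
    using neq by (elim bounded_range_cong) (simp add: field_simps)
  with unbounded show False ..
qed

end

section \<open>The three alternatives\<close>

theorem theorem5p6:
  fixes K :: "'g::{topological_group_add, t2_space} set"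
    and M :: "'g measure" and \<delta> :: real
    and \<mu> f g :: "'g \<Rightarrow> complex"
  assumes "locally_compact_space (euclidean :: 'g topology)"
    and "compact_subgroup K"
    and "normalized_haar K M"
    and "\<delta> > 0"
    and "unitary_character \<mu>"
    and "continuous_on UNIV f" and "continuous_on UNIV g"
    and "K_central K f"
    and "\<forall>x y. norm (KS M \<mu> f x y - 2 * f x * g y) \<le> \<delta>"
  shows "(bounded (range f) \<and> bounded (range g))
      \<or> (\<not> bounded (range f) \<and> (\<forall>x y. KS M \<mu> g x y = 2 * g x * g y))
      \<or> (\<not> bounded (range g) \<and> (\<forall>x y. KS M \<mu> f x y = 2 * f x * g y)
          \<and> (f \<noteq> (\<lambda>x. 0) \<and> C_K M f \<noteq> (\<lambda>x. 0) \<longrightarrow> (\<forall>x y. KS M \<mu> g x y = 2 * g x * g y)))"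
proof -
  interpret approximate_wilson K M \<mu> f g \<delta>
    using assms by unfold_locales auto
  have "f = (\<lambda>x. 0)" if f_bdd: "bounded (range f)" and g_unbdd: "\<not> bounded (range g)"
  proof (rule ccontr)
    assume "f \<noteq> (\<lambda>x. 0)"
    then obtain x where x: "f x \<noteq> 0" by auto
    obtain B where B: "\<And>x. norm (f x) \<le> B" using f_bdd by (auto simp: bounded_iff)
    \<comment> \<open>Both averages of f are bounded by B and \<mu> has modulus one, so 2 |f(x)|
      |g(y)| is at most \<delta> + 2 B for every y, with x fixed.\<close>
    have "norm (g y) \<le> (\<delta> + 2 * B) / (2 * norm (f x))" for y
    proof -
      have "norm (KS M \<mu> f x y) \<le> 2 * B"
        using norm_triangle_ineq[of "avg y f x" "\<mu> y * avg (- y) f x"] norm_avg_le[OF f B, of y x]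
          norm_avg_le[OF f B, of "- y" x] character
        by (simp add: KS_eq_avg norm_mult unitary_character_def)
      then have "norm (2 * f x * g y) \<le> \<delta> + 2 * B"
        using approx[of x y] norm_triangle_ineq4[of "KS M \<mu> f x y" "KS M \<mu> f x y - 2 * f x * g y"]
        by simp
      then show ?thesis
        using x by (simp add: norm_mult field_simps)
    qed
    then have "bounded (range g)" by (auto simp: bounded_iff)
    with g_unbdd show False ..
  qed
  \<comment> \<open>Unbounded f falls under the second alternative. For bounded f and unbounded g, f
    = 0 makes both sides of the equation for f vanish and the premise of the final implication
    false.\<close>
  then show ?thesis
    using KS_eq_of_unbounded by (cases "bounded (range f)"; cases "bounded (range g)") (auto simp: KS_def)
qed

end
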